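(* Assume that $\mathbb{S}$ is a subset of a normed vector space and that the adaptation has the form $$S_k=S_{k-1}+\gamma_kH_k,\qquad k\ge1,$$ where $H_k$ is $\mathcal{F}_k$-measurable and $(\gamma_k)_{k\ge1}$ is a sequence of positive numbers. Suppose there exist constants $C<\infty$ and $\rho\in[0,1)$ such that $d_{\mathrm{tv}}(P_s^k(x,\cdot),\pi)\le C\rho^k$ for all $x\in\mathbb{X}$, $s\in\mathbb{S}$, $k\ge0$, and a constant $L<\infty$ such that $$\sup_{x\in\mathbb{X}}d_{\mathrm{tv}}\big(P_s(x,\cdot),P_{s'}(x,\cdot)\big)\le L\|s-s'\|\qquad\text{for all }s,s'\in\mathbb{S}.$$ (i) If $\gamma_k\mathbb{E}[\|H_k\|]\to0$ as $k\to\infty$, then the adaptation is weakly $1$-waning. (ii) If $\sum_{k=1}^\infty\frac{\gamma_k}{k^p}\mathbb{E}[\|H_k\|]<\infty$ for some $p>0$, then the adaptation is strongly $p$-waning.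
   Context: $(\mathbb{X},\mathcal{X})$ and $(\mathbb{S},\mathcal{S})$ are measurable spaces. $\pi$ is a probability measure on $\mathbb{X}$ and $\{P_s\}_{s\in\mathbb{S}}$ is a family of Markov transition probabilities on $\mathbb{X}$, each $\pi$-invariant, such that $(s,x)\mapsto P_s(x,A)$ is $\mathcal{S}\otimes\mathcal{X}$-measurable for all $A\in\mathcal{X}$. $(S_k,X_k)_{k\ge0}$ is an $\mathbb{S}\times\mathbb{X}$-valued stochastic process adapted to a filtration $(\mathcal{F}_k)_{k\ge0}$ such that for all $k\ge0$ and $A\in\mathcal{X}$, $\mathbb{P}(X_{k+1}\in A\mid\mathcal{F}_k)=P_{S_k}(X_k,A)$ a.s. The norms $\|H_k\|$ are random variables. Waning adaptation: for $p>0$, the adaptation is called weakly (respectively, strongly) $p$-waning if there are random variables $D_k$, $k\ge1$, with values in $[0,1]$ such that $\sup_{x\in\mathbb{X}}d_{\mathrm{tv}}\big(P_{S_k}(x,\cdot),P_{S_{k-1}}(x,\cdot)\big)\le D_k$ for all $k\ge1$, and $n^{-p}\sum_{k=1}^nD_k\to0$ in probability (respectively, almost surely) as $n\to\infty$. Notation: $d_{\mathrm{tv}}(\mu,\nu)=\sup_A|\mu(A)-\nu(A)|$; $P^k$ is the $k$-step transition, $P^0$ the identity, $\rho^0=1$. *)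

theory Defs
  imports "HOL-Probability.Probability"
begin

(* Only meant for probability measures with sets \<mu> = sets \<nu>; the real supremum is then
   over a nonempty subset of [0,1]. *)
definition tv_dist :: "'x measure \<Rightarrow> 'x measure \<Rightarrow> real" where
  "tv_dist \<mu> \<nu> = (SUP A\<in>sets \<mu>. \<bar>measure \<mu> A - measure \<nu> A\<bar>)"

primrec kernel_power :: "'x measure \<Rightarrow> ('x \<Rightarrow> 'x measure) \<Rightarrow> nat \<Rightarrow> 'x \<Rightarrow> 'x measure" where
  "kernel_power MX K 0 x = return MX x"
| "kernel_power MX K (Suc k) x = kernel_power MX K k x \<bind> K"

locale adaptive_chain = prob_space M + filtration "space M" F
  for M :: "'w measure" and F :: "nat \<Rightarrow> 'w measure" +
  fixes MS :: "'s measure" and MX :: "'x measure"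
    and \<pi> :: "'x measure" and P :: "'s \<Rightarrow> 'x \<Rightarrow> 'x measure"
    and S :: "nat \<Rightarrow> 'w \<Rightarrow> 's" and X :: "nat \<Rightarrow> 'w \<Rightarrow> 'x"
  assumes prob_space_pi: "prob_space \<pi>"
    and sets_pi: "sets \<pi> = sets MX"
    and kernel: "\<And>s. s \<in> space MS \<Longrightarrow> P s \<in> MX \<rightarrow>\<^sub>M prob_algebra MX"
    and kernel_joint: "\<And>A. A \<in> sets MX \<Longrightarrow>
          (\<lambda>(s, x). measure (P s x) A) \<in> borel_measurable (MS \<Otimes>\<^sub>M MX)"
    and invariant: "\<And>s. s \<in> space MS \<Longrightarrow> \<pi> \<bind> P s = \<pi>"
    and subalgebra_F: "\<And>k. subalgebra M (F k)"
    and adapted_S: "\<And>k. S k \<in> F k \<rightarrow>\<^sub>M MS"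
    and adapted_X: "\<And>k. X k \<in> F k \<rightarrow>\<^sub>M MX"
    and transition: "\<And>k A. A \<in> sets MX \<Longrightarrow>
          (AE \<omega> in M. real_cond_exp M (F k) (\<lambda>\<omega>. indicator A (X (Suc k) \<omega>)) \<omega>
                       = measure (P (S k \<omega>) (X k \<omega>)) A)"

definition tendsto_in_prob :: "'w measure \<Rightarrow> (nat \<Rightarrow> 'w \<Rightarrow> real) \<Rightarrow> ('w \<Rightarrow> real) \<Rightarrow> bool" where
  "tendsto_in_prob M Y Z \<longleftrightarrow>
     (\<forall>\<epsilon>>0. (\<lambda>n. measure M {\<omega>\<in>space M. \<bar>Y n \<omega> - Z \<omega>\<bar> > \<epsilon>}) \<longlonglongrightarrow> 0)"

(* The value D 0 is irrelevant: all conditions concern indices k \<ge> 1. *)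
definition adaptation_bound ::
  "'w measure \<Rightarrow> 'x measure \<Rightarrow> ('s \<Rightarrow> 'x \<Rightarrow> 'x measure) \<Rightarrow> (nat \<Rightarrow> 'w \<Rightarrow> 's) \<Rightarrow> (nat \<Rightarrow> 'w \<Rightarrow> real) \<Rightarrow> bool"
where
  "adaptation_bound M MX P S D \<longleftrightarrow>
     (\<forall>k\<ge>1. D k \<in> borel_measurable M \<and>
        (\<forall>\<omega>\<in>space M. D k \<omega> \<in> {0..1} \<and>
           (SUP x\<in>space MX. tv_dist (P (S k \<omega>) x) (P (S (k - 1) \<omega>) x)) \<le> D k \<omega>))"

definition weakly_waning ::
  "'w measure \<Rightarrow> 'x measure \<Rightarrow> ('s \<Rightarrow> 'x \<Rightarrow> 'x measure) \<Rightarrow> (nat \<Rightarrow> 'w \<Rightarrow> 's) \<Rightarrow> real \<Rightarrow> bool"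
where
  "weakly_waning M MX P S p \<longleftrightarrow>
     (\<exists>D. adaptation_bound M MX P S D \<and>
        tendsto_in_prob M (\<lambda>n \<omega>. real n powr (- p) * (\<Sum>k=1..n. D k \<omega>)) (\<lambda>_. 0))"

definition strongly_waning ::
  "'w measure \<Rightarrow> 'x measure \<Rightarrow> ('s \<Rightarrow> 'x \<Rightarrow> 'x measure) \<Rightarrow> (nat \<Rightarrow> 'w \<Rightarrow> 's) \<Rightarrow> real \<Rightarrow> bool"
where
  "strongly_waning M MX P S p \<longleftrightarrow>
     (\<exists>D. adaptation_bound M MX P S D \<and>
        (AE \<omega> in M. (\<lambda>n. real n powr (- p) * (\<Sum>k=1..n. D k \<omega>)) \<longlonglongrightarrow> 0))"

end

theory Submission
  imports Defs
begin

text \<open>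
  The waning bounds are the truncations \<open>D k = min 1 (\<bar>L\<bar> \<gamma> k \<parallel>H k\<parallel>)\<close>. For (i), their expectations
  tend to 0, hence so do their Cesaro means, and Markov's inequality applies. For (ii), the series
  of \<open>D k / k powr p\<close> has finite expectation, so it converges almost surely, and Kronecker's lemma
  applies.
\<close>

section \<open>Limits of averages of real sequences\<close>

lemma cesaro_mean_tendsto_zero:
  fixes d :: "nat \<Rightarrow> real"
  assumes "d \<longlonglongrightarrow> 0"
  shows "(\<lambda>n. (\<Sum>k=1..n. d k) / real n) \<longlonglongrightarrow> 0"
proof (rule LIMSEQ_I)
  fix e :: real assume e: "0 < e"
  obtain N where N: "\<And>k. k \<ge> N \<Longrightarrow> \<bar>d k\<bar> < e / 2"
    using LIMSEQ_D[OF assms, of "e / 2"] e by auto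
  \<comment> \<open>\<open>K\<close> absorbs the finitely many terms not yet below
    \<open>e / 2\<close>. It does not depend on \<open>n\<close>, so dividing by \<open>n\<close>
    makes its share of the mean less than the other \<open>e / 2\<close>.\<close>
  define K where "K = (\<Sum>k<N. \<bar>d k\<bar>)"
  have "((\<lambda>n. K / real n) \<longlonglongrightarrow> 0)"
    by (rule lim_const_over_n)
  then obtain m where m: "\<And>n. n \<ge> m \<Longrightarrow> \<bar>K / real n\<bar> < e / 2"
    using LIMSEQ_D[of "\<lambda>n. K / real n" 0 "e / 2"] e by auto
  show "\<exists>no. \<forall>n\<ge>no. norm ((\<Sum>k=1..n. d k) / real n - 0) < e"
  proof (intro exI allI impI)
    fix n assume n: "n \<ge> max 1 m"
    have "\<bar>\<Sum>k=1..n. d k\<bar> \<le> (\<Sum>k=1..n. \<bar>d k\<bar>)"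
      by (rule sum_abs)
    \<comment> \<open>Granting \<open>e / 2\<close> to the early indices as well costs nothing and
      lets the sum split into a head and a constant part.\<close>
    also have "\<dots> \<le> (\<Sum>k=1..n. (if k < N then \<bar>d k\<bar> else 0) + e / 2)"
      using N e by (intro sum_mono) (auto simp: not_less less_imp_le)
    also have "\<dots> = (\<Sum>k\<in>{1..n} \<inter> {..<N}. \<bar>d k\<bar>) + real n * (e / 2)"
      by (simp add: sum.distrib sum.inter_restrict)
    also have "\<dots> \<le> K + real n * (e / 2)"
      unfolding K_def by (intro add_right_mono sum_mono2) auto
    finally have "\<bar>\<Sum>k=1..n. d k\<bar> / real n \<le> K / real n + e / 2"
      using n by (simp add: field_simps)
    also have "\<dots> < e"
      using m[of n] n abs_ge_self[of "K / real n"] by linarith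
    finally show "norm ((\<Sum>k=1..n. d k) / real n - 0) < e"
      by simp
  qed
qed

text \<open>Kronecker's lemma is Tannery's theorem for the array
  \<open>(k / n) powr p * (d k / k powr p)\<close>, which is dominated by the convergent series.\<close>

lemma kronecker_powr:
  fixes d :: "nat \<Rightarrow> real"
  assumes p: "p > 0"
    and nonneg: "\<And>k. k \<ge> 1 \<Longrightarrow> 0 \<le> d k"
    and summable: "summable (\<lambda>k. d (Suc k) / real (Suc k) powr p)"
  shows "(\<lambda>n. real n powr (- p) * (\<Sum>k=1..n. d k)) \<longlonglongrightarrow> 0"
proof -
  \<comment> \<open>Series count from 0, so column \<open>k\<close> carries
    \<open>d (Suc k)\<close>. The cutoff \<open>k < n\<close> turns the partial sum up to
    \<open>n\<close> into a full series.\<close>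
  define a where "a k n = (if k < n then real n powr (- p) * d (Suc k) else 0)" for k n
  have lim: "(\<lambda>n. a k n) \<longlonglongrightarrow> 0" for k
  proof -
    have "(\<lambda>n. real n powr (- p)) \<longlonglongrightarrow> 0"
      using p by (intro tendsto_neg_powr filterlim_real_sequentially) auto
    then have "(\<lambda>n. real n powr (- p) * d (Suc k)) \<longlonglongrightarrow> 0"
      by (rule tendsto_mult_left_zero)
    moreover have "eventually (\<lambda>n. real n powr (- p) * d (Suc k) = a k n) sequentially"
      using eventually_gt_at_top[of k] by eventually_elim (simp add: a_def)
    ultimately show ?thesis
      by (rule Lim_transform_eventually)
  qed
  have bound: "norm (a k n) \<le> d (Suc k) / real (Suc k) powr p" for k n
  proof (cases "k < n")
    case True
    \<comment> \<open>Here \<open>Suc k \<le> n\<close>, and a negative power is decreasing; this is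
      what makes the dominating term independent of \<open>n\<close>.\<close>
    have "real n powr (- p) \<le> real (Suc k) powr (- p)"
      using True p by (intro powr_mono2') auto
    then have "d (Suc k) * real n powr (- p) \<le> d (Suc k) * real (Suc k) powr (- p)"
      using nonneg[of "Suc k"] by (intro mult_left_mono) auto
    then show ?thesis
      using True nonneg[of "Suc k"] by (simp add: a_def powr_minus divide_inverse abs_mult mult.commute)
  next
    case False
    then show ?thesis
      using nonneg[of "Suc k"] by (simp add: a_def)
  qed
  have "\<forall>\<^sub>F (k, n) in sequentially \<times>\<^sub>F sequentially. norm (a k n) \<le> d (Suc k) / real (Suc k) powr p"
    using bound by (intro always_eventually) blast
  then have "(\<lambda>n. \<Sum>k. a k n) \<longlonglongrightarrow> (\<Sum>k. 0)"
    using tannerys_theorem[of a "\<lambda>_. 0" sequentially, OF lim _ summable trivial_limit_sequentially]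
    by blast
  moreover have "(\<Sum>k. a k n) = real n powr (- p) * (\<Sum>k=1..n. d k)" for n
  proof -
    have "(\<Sum>k. a k n) = (\<Sum>k<n. a k n)"
      by (rule suminf_finite) (auto simp: a_def)
    also have "\<dots> = real n powr (- p) * (\<Sum>k<n. d (Suc k))"
      by (simp add: a_def sum_distrib_left)
    also have "(\<Sum>k<n. d (Suc k)) = (\<Sum>k=1..n. d k)"
      using sum.atLeast1_atMost_eq[of d n] by simp
    finally show ?thesis .
  qed
  ultimately show ?thesis
    by simp
qed

section \<open>Averages of random variables\<close>

lemma (in prob_space) averages_tendsto_in_prob_zero:
  assumes meas: "\<And>k. k \<ge> 1 \<Longrightarrow> D k \<in> borel_measurable M"
    and range: "\<And>k \<omega>. k \<ge> 1 \<Longrightarrow> \<omega> \<in> space M \<Longrightarrow> D k \<omega> \<in> {0..1}"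
    and lim: "(\<lambda>k. expectation (D k)) \<longlonglongrightarrow> 0"
  shows "tendsto_in_prob M (\<lambda>n \<omega>. real n powr (- 1) * (\<Sum>k=1..n. D k \<omega>)) (\<lambda>_. 0)"
  unfolding tendsto_in_prob_def
proof (intro allI impI)
  fix e :: real assume e: "e > 0"
  define Y where "Y n \<omega> = real n powr (- 1) * (\<Sum>k=1..n. D k \<omega>)" for n \<omega>
  have int: "integrable M (D k)" if "k \<ge> 1" for k
    using range[OF that] meas[OF that]
    by (intro integrable_const_bound[where B = 1]) auto
  have int_Y: "integrable M (Y n)" for n
    unfolding Y_def by (intro integrable_mult_right Bochner_Integration.integrable_sum int) auto
  have nonneg: "0 \<le> Y n \<omega>" if "\<omega> \<in> space M" for n \<omega>
    unfolding Y_def using range that by (intro mult_nonneg_nonneg sum_nonneg) auto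
  have exp_Y: "expectation (Y n) = (\<Sum>k=1..n. expectation (D k)) / real n" for n
  proof -
    have "expectation (\<lambda>\<omega>. \<Sum>k=1..n. D k \<omega>) = (\<Sum>k=1..n. expectation (D k))"
      using int by (intro Bochner_Integration.integral_sum) auto
    then show ?thesis
      by (simp add: Y_def[abs_def] powr_minus_divide)
  qed
  have upper: "(\<lambda>n. expectation (Y n) / e) \<longlonglongrightarrow> 0"
    using tendsto_divide[OF cesaro_mean_tendsto_zero[OF lim] tendsto_const[of e]] e
    by (simp add: exp_Y)
  have le: "prob {\<omega>\<in>space M. \<bar>Y n \<omega> - 0\<bar> > e} \<le> expectation (Y n) / e" for n
  proof -
    have [measurable]: "Y n \<in> borel_measurable M"
      using int_Y by auto
    \<comment> \<open>Markov's inequality is stated for the event with \<open>\<ge>\<close>, so the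
      strict event is enlarged first; the absolute value drops because \<open>Y n\<close> is
      nonnegative.\<close>
    have "prob {\<omega>\<in>space M. \<bar>Y n \<omega> - 0\<bar> > e} \<le> prob {\<omega>\<in>space M. Y n \<omega> \<ge> e}"
      using nonneg by (intro finite_measure_mono) auto
    also have "\<dots> \<le> expectation (Y n) / e"
      using nonneg e by (intro integral_Markov_inequality_measure[OF int_Y sets.top]) auto
    finally show ?thesis .
  qed
  have "(\<lambda>n. prob {\<omega>\<in>space M. \<bar>Y n \<omega> - 0\<bar> > e}) \<longlonglongrightarrow> 0"
    by (rule tendsto_sandwich[OF _ _ tendsto_const upper]) (use le in auto)
  then show "(\<lambda>n. prob {\<omega>\<in>space M. \<bar>real n powr (- 1) * (\<Sum>k=1..n. D k \<omega>) - 0\<bar> > e}) \<longlonglongrightarrow> 0"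
    unfolding Y_def .
qed

text \<open>Monotone convergence moves the sum inside the integral, so the random series has a
  finite integral and is finite almost everywhere. Kronecker's lemma then applies to each such
  path.\<close>

lemma AE_weighted_averages_tendsto_zero:
  assumes p: "p > 0"
    and meas: "\<And>k. k \<ge> 1 \<Longrightarrow> D k \<in> borel_measurable M"
    and nonneg: "\<And>k \<omega>. k \<ge> 1 \<Longrightarrow> \<omega> \<in> space M \<Longrightarrow> 0 \<le> D k \<omega>"
    and finite: "(\<Sum>k. \<integral>\<^sup>+ \<omega>. ennreal (D (Suc k) \<omega> / real (Suc k) powr p) \<partial>M) < \<infinity>"
  shows "AE \<omega> in M. (\<lambda>n. real n powr (- p) * (\<Sum>k=1..n. D k \<omega>)) \<longlonglongrightarrow> 0"
proof -
  define f where "f k \<omega> = D (Suc k) \<omega> / real (Suc k) powr p" for k \<omega>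
  have [measurable]: "f k \<in> borel_measurable M" for k
    unfolding f_def using meas[of "Suc k"] by (intro borel_measurable_divide) auto
  have "(\<integral>\<^sup>+ \<omega>. (\<Sum>k. ennreal (f k \<omega>)) \<partial>M) = (\<Sum>k. \<integral>\<^sup>+ \<omega>. ennreal (f k \<omega>) \<partial>M)"
    by (rule nn_integral_suminf) measurable
  then have "(\<integral>\<^sup>+ \<omega>. (\<Sum>k. ennreal (f k \<omega>)) \<partial>M) \<noteq> \<infinity>"
    using finite unfolding f_def by simp
  then have "AE \<omega> in M. (\<Sum>k. ennreal (f k \<omega>)) \<noteq> \<infinity>"
    by (intro nn_integral_PInf_AE) auto
  then show ?thesis
    using AE_space
  proof eventually_elim
    case (elim \<omega>)
    \<comment> \<open>For nonnegative terms, a finite sum in \<open>ennreal\<close> amounts to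
      summability over the reals.\<close>
    then have "summable (\<lambda>k. f k \<omega>)"
      using nonneg by (intro summable_suminf_not_top) (auto simp: f_def)
    then show ?case
      using p nonneg elim by (intro kronecker_powr) (auto simp: f_def)
  qed
qed

section \<open>Total variation between kernels\<close>

lemma tv_dist_le_1:
  assumes "prob_space \<mu>" "prob_space \<nu>"
  shows "tv_dist \<mu> \<nu> \<le> 1"
  unfolding tv_dist_def
proof (rule cSUP_least)
  show "sets \<mu> \<noteq> {}"
    using sets.top by blast
  fix A
  show "\<bar>measure \<mu> A - measure \<nu> A\<bar> \<le> 1"
    using prob_space.prob_le_1[OF assms(1), of A] prob_space.prob_le_1[OF assms(2), of A]
      measure_nonneg[of \<mu> A] measure_nonneg[of \<nu> A] by linarith
qed

context adaptive_chain
begin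

lemma S_in_space: "\<omega> \<in> space M \<Longrightarrow> S k \<omega> \<in> space MS"
  using measurable_space[OF adapted_S[of k]] subalgebra_F[of k] by (simp add: subalgebra_def)

lemma X_in_space: "\<omega> \<in> space M \<Longrightarrow> X k \<omega> \<in> space MX"
  using measurable_space[OF adapted_X[of k]] subalgebra_F[of k] by (simp add: subalgebra_def)

text \<open>This justifies capping the waning bound at 1. The supremum is over a nonempty set
  because the chain takes values in \<open>space MX\<close> on the nonempty space of a probability
  measure.\<close>

lemma SUP_tv_dist_kernel_le_1:
  assumes "s \<in> space MS" "s' \<in> space MS"
  shows "(SUP x\<in>space MX. tv_dist (P s x) (P s' x)) \<le> 1"
proof (rule cSUP_least)
  show "space MX \<noteq> {}"
    using not_empty X_in_space by blast
  have "prob_space (P s x)" if "s \<in> space MS" "x \<in> space MX" for s x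
    using measurable_space[OF kernel[OF that(1)] that(2)] by (simp add: space_prob_algebra)
  then show "tv_dist (P s x) (P s' x) \<le> 1" if "x \<in> space MX" for x
    using assms that by (intro tv_dist_le_1) auto
qed

end

theorem lemma16:
  fixes M :: "'w measure" and F :: "nat \<Rightarrow> 'w measure"
    and MS MV :: "'s::real_normed_vector measure" and MX \<pi> :: "'x measure"
    and P :: "'s \<Rightarrow> 'x \<Rightarrow> 'x measure"
    and S H :: "nat \<Rightarrow> 'w \<Rightarrow> 's" and X :: "nat \<Rightarrow> 'w \<Rightarrow> 'x"
    and \<gamma> :: "nat \<Rightarrow> real" and C \<rho> L :: real
  assumes "adaptive_chain M F MS MX \<pi> P S X"
    and "\<And>k \<omega>. k \<ge> 1 \<Longrightarrow> \<omega> \<in> space M \<Longrightarrow> S k \<omega> = S (k - 1) \<omega> + \<gamma> k *\<^sub>R H k \<omega>"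
    and "\<And>k. k \<ge> 1 \<Longrightarrow> \<gamma> k > 0"
    and "space MV = UNIV"
    and "\<And>k. k \<ge> 1 \<Longrightarrow> H k \<in> F k \<rightarrow>\<^sub>M MV"
    and "\<And>k. k \<ge> 1 \<Longrightarrow> (\<lambda>\<omega>. norm (H k \<omega>)) \<in> borel_measurable M"
    and "0 \<le> \<rho>" and "\<rho> < 1"
    and "\<And>s x k. s \<in> space MS \<Longrightarrow> x \<in> space MX \<Longrightarrow>
           tv_dist (kernel_power MX (P s) k x) \<pi> \<le> C * \<rho> ^ k"
    and "\<And>s s'. s \<in> space MS \<Longrightarrow> s' \<in> space MS \<Longrightarrow>
           (SUP x\<in>space MX. tv_dist (P s x) (P s' x)) \<le> L * norm (s - s')"
  shows "((\<lambda>k. ennreal (\<gamma> k) * (\<integral>\<^sup>+ \<omega>. ennreal (norm (H k \<omega>)) \<partial>M)) \<longlonglongrightarrow> 0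
            \<longrightarrow> weakly_waning M MX P S 1)
       \<and> (\<forall>p>0. (\<Sum>k. ennreal (\<gamma> (Suc k) / real (Suc k) powr p)
                        * (\<integral>\<^sup>+ \<omega>. ennreal (norm (H (Suc k) \<omega>)) \<partial>M)) < \<infinity>
            \<longrightarrow> strongly_waning M MX P S p)"
proof -
  interpret adaptive_chain M F MS MX \<pi> P S X
    by (rule assms(1))
  \<comment> \<open>The sign of \<open>L\<close> is not assumed; \<open>\<bar>L\<bar>\<close> keeps
    the values in [0,1] for \<open>k \<ge> 1\<close>.\<close>
  define D where "D k \<omega> = min 1 (\<bar>L\<bar> * (\<gamma> k * norm (H k \<omega>)))" for k \<omega>
  \<comment> \<open>As a nonnegative integral, \<open>E k\<close> records an infinite expectation as
    infinity, where the Bochner integral would give 0.\<close>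
  define E where "E k = (\<integral>\<^sup>+ \<omega>. ennreal (norm (H k \<omega>)) \<partial>M)" for k
  have meas: "D k \<in> borel_measurable M" if "k \<ge> 1" for k
    unfolding D_def using assms(6)[OF that] by measurable
  have range: "D k \<omega> \<in> {0..1}" if "k \<ge> 1" for k \<omega>
    unfolding D_def using assms(3)[OF that] by simp
  \<comment> \<open>One estimate serves both parts: (i) takes \<open>c = 1\<close>, (ii) takes the
    reciprocal of \<open>k powr p\<close>.\<close>
  have nn_D: "(\<integral>\<^sup>+ \<omega>. ennreal (c * D k \<omega>) \<partial>M) \<le> ennreal \<bar>L\<bar> * (ennreal (c * \<gamma> k) * E k)"
    if "k \<ge> 1" "c \<ge> 0" for k c
  proof -
    have pos: "\<gamma> k > 0"
      using assms(3) that by simp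
    have "(\<integral>\<^sup>+ \<omega>. ennreal (c * D k \<omega>) \<partial>M)
        \<le> (\<integral>\<^sup>+ \<omega>. ennreal \<bar>L\<bar> * (ennreal (c * \<gamma> k) * ennreal (norm (H k \<omega>))) \<partial>M)"
    proof (rule nn_integral_mono)
      fix \<omega>
      have "c * D k \<omega> \<le> c * (\<bar>L\<bar> * (\<gamma> k * norm (H k \<omega>)))"
        unfolding D_def using that by (intro mult_left_mono) auto
      also have "\<dots> = \<bar>L\<bar> * (c * \<gamma> k * norm (H k \<omega>))"
        by simp
      finally have "ennreal (c * D k \<omega>) \<le> ennreal (\<bar>L\<bar> * (c * \<gamma> k * norm (H k \<omega>)))"
        by (rule ennreal_leI)
      also have "\<dots> = ennreal \<bar>L\<bar> * (ennreal (c * \<gamma> k) * ennreal (norm (H k \<omega>)))"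
        using pos that by (simp add: ennreal_mult)
      finally show "ennreal (c * D k \<omega>) \<le> \<dots>" .
    qed
    also have "\<dots> = ennreal \<bar>L\<bar> * (ennreal (c * \<gamma> k) * E k)"
      unfolding E_def using assms(6)[OF that(1)] by (simp add: nn_integral_cmult)
    finally show ?thesis .
  qed
  have bound: "adaptation_bound M MX P S D"
    unfolding adaptation_bound_def
  proof (intro allI impI conjI ballI)
    fix k :: nat and \<omega> assume k: "1 \<le> k" and \<omega>: "\<omega> \<in> space M"
    let ?d = "SUP x\<in>space MX. tv_dist (P (S k \<omega>) x) (P (S (k - 1) \<omega>) x)"
    have "?d \<le> L * norm (S k \<omega> - S (k - 1) \<omega>)"
      by (rule assms(10)[OF S_in_space[OF \<omega>] S_in_space[OF \<omega>]])
    also have "\<dots> = L * (\<gamma> k * norm (H k \<omega>))"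
      using assms(2)[OF k \<omega>] assms(3)[OF k] by simp
    also have "\<dots> \<le> \<bar>L\<bar> * (\<gamma> k * norm (H k \<omega>))"
      using assms(3)[OF k] by (intro mult_right_mono) auto
    finally show "?d \<le> D k \<omega>"
      unfolding D_def using SUP_tv_dist_kernel_le_1[OF S_in_space[OF \<omega>] S_in_space[OF \<omega>]] by simp
  qed (use meas range in auto)
  have "weakly_waning M MX P S 1" if "(\<lambda>k. ennreal (\<gamma> k) * E k) \<longlonglongrightarrow> 0"
  proof -
    \<comment> \<open>Truncation makes \<open>D k\<close> integrable even when
      \<open>norm (H k)\<close> is not, so its real expectation is meaningful.\<close>
    have exp_D: "ennreal (expectation (D k)) = (\<integral>\<^sup>+ \<omega>. ennreal (D k \<omega>) \<partial>M)" if "k \<ge> 1" for k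
      using range[OF that] meas[OF that]
      by (intro nn_integral_eq_integral[symmetric] integrable_const_bound[where B = 1]) auto
    have upper: "(\<lambda>k. ennreal \<bar>L\<bar> * (ennreal (\<gamma> k) * E k)) \<longlonglongrightarrow> 0"
      using ennreal_tendsto_cmult[OF ennreal_less_top that, of "\<bar>L\<bar>"] by simp
    have "eventually (\<lambda>k. ennreal (expectation (D k)) \<le> ennreal \<bar>L\<bar> * (ennreal (\<gamma> k) * E k)) sequentially"
      using eventually_ge_at_top[of 1]
    proof eventually_elim
      case (elim k)
      then show ?case
        using nn_D[of k 1] exp_D[of k] by simp
    qed
    then have "(\<lambda>k. ennreal (expectation (D k))) \<longlonglongrightarrow> ennreal 0"
      using tendsto_sandwich[OF _ _ tendsto_const upper] by simp
    \<comment> \<open>Since \<open>ennreal\<close> sends negative reals to 0, the limit transfers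
      back to the reals only with eventual nonnegativity.\<close>
    moreover have "eventually (\<lambda>k. 0 \<le> expectation (D k)) sequentially"
      using eventually_ge_at_top[of 1]
      by eventually_elim (intro integral_nonneg_AE AE_I2, use range in auto)
    ultimately have "(\<lambda>k. expectation (D k)) \<longlonglongrightarrow> 0"
      by (subst (asm) tendsto_ennreal_iff) auto
    then have "tendsto_in_prob M (\<lambda>n \<omega>. real n powr (- 1) * (\<Sum>k=1..n. D k \<omega>)) (\<lambda>_. 0)"
      by (intro averages_tendsto_in_prob_zero meas range)
    with bound show ?thesis
      unfolding weakly_waning_def by blast
  qed
  moreover have "strongly_waning M MX P S p"
    if p: "p > 0" and fin: "(\<Sum>k. ennreal (\<gamma> (Suc k) / real (Suc k) powr p) * E (Suc k)) < \<infinity>" for p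
  proof -
    have "(\<Sum>k. \<integral>\<^sup>+ \<omega>. ennreal (D (Suc k) \<omega> / real (Suc k) powr p) \<partial>M)
        \<le> (\<Sum>k. ennreal \<bar>L\<bar> * (ennreal (\<gamma> (Suc k) / real (Suc k) powr p) * E (Suc k)))"
    proof (intro suminf_le)
      fix k
      show "(\<integral>\<^sup>+ \<omega>. ennreal (D (Suc k) \<omega> / real (Suc k) powr p) \<partial>M)
          \<le> ennreal \<bar>L\<bar> * (ennreal (\<gamma> (Suc k) / real (Suc k) powr p) * E (Suc k))"
        using nn_D[of "Suc k" "1 / real (Suc k) powr p"] by simp
    qed auto
    also have "\<dots> = ennreal \<bar>L\<bar> * (\<Sum>k. ennreal (\<gamma> (Suc k) / real (Suc k) powr p) * E (Suc k))"
      by (rule ennreal_suminf_cmult)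
    also have "\<dots> < \<infinity>"
      using fin by (simp add: ennreal_mult_less_top)
    finally have "AE \<omega> in M. (\<lambda>n. real n powr (- p) * (\<Sum>k=1..n. D k \<omega>)) \<longlonglongrightarrow> 0"
      using p meas range by (intro AE_weighted_averages_tendsto_zero) auto
    then show ?thesis
      unfolding strongly_waning_def using bound by blast
  qed
  ultimately show ?thesis
    unfolding E_def by blast
qed

end
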